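(* Let $(a_n)_{n\ge 0}\in\mathbb{Z}^{\mathbb{N}}$ be a primary pseudo-polynomial. Assume that there exist a real number $u$, a function $F(x)$ analytic in the right half-plane $\Re(x)>u$ such that $a_n=F(n)$ for all integers $n\ge 0$ with $n>u$, and real numbers $c>0$ and $0<\rho<\log(2\sqrt{e})$ such that $$|F(x)|\le c\cdot e^{\rho\,\Re(x)}\quad\text{for all complex } x \text{ with } \Re(x)>u.$$ Then $F(x)$ is in $\mathbb{Q}[x]$ and $(a_n)_{n\ge 0}$ is a polynomial.
   Context: $\mathbb{N}=\{0,1,2,\dots\}$. A sequence $(a_n)_{n\ge 0}\in\mathbb{Z}^{\mathbb{N}}$ is a primary pseudo-polynomial if for every integer $n\ge 0$ and every prime number $p$, $a_{n+p}\equiv a_n \pmod p$. The sequence $(a_n)_{n\ge 0}$ "is a polynomial" if there exists $P(X)\in\mathbb{Q}[X]$ such that $a_n=P(n)$ for all integers $n\ge 0$. "$F(x)$ is in $\mathbb{Q}[x]$" means that $F$ coincides on its half-plane with a polynomial function with rational coefficients. Here $e$ is the base of the natural logarithm and $\log$ is the natural logarithm. *)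

theory Defs
  imports "HOL-Analysis.Analysis" "HOL-Number_Theory.Cong"
    "HOL-Computational_Algebra.Polynomial" "HOL-Computational_Algebra.Primes"
begin

definition primary_pseudo_polynomial :: "(nat \<Rightarrow> int) \<Rightarrow> bool" where
  "primary_pseudo_polynomial a \<longleftrightarrow>
     (\<forall>n p :: nat. prime p \<longrightarrow> [a (n + p) = a n] (mod int p))"

definition is_polynomial :: "(nat \<Rightarrow> int) \<Rightarrow> bool" where
  "is_polynomial a \<longleftrightarrow> (\<exists>P :: rat poly. \<forall>n. of_int (a n) = poly P (of_nat n))"

definition rational_polynomial_on :: "complex set \<Rightarrow> (complex \<Rightarrow> complex) \<Rightarrow> bool" where
  "rational_polynomial_on S F \<longleftrightarrow>
     (\<exists>P :: rat poly. \<forall>x\<in>S. F x = poly (map_poly of_rat P) x)"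

end

theory Submission
  imports Defs "HOL-Complex_Analysis.Complex_Analysis" "HOL-Real_Asymp.Real_Asymp"
begin

text \<open>
  The theorem comes from a conflict between an arithmetic lower bound and an analytic upper bound
  for the iterated forward differences of the sequence at a fixed point.

  Arithmetic: modulo a prime \<open>p\<close> the operator \<open>\<Delta>\<^sup>p = (E - 1)\<^sup>p\<close>, with \<open>E\<close> the shift, equals
  \<open>E\<^sup>p - 1\<close>, and this kills a primary pseudo-polynomial. So every prime \<open>p \<le> k\<close> divides the
  \<open>k\<close>-th difference, and hence so does the product of these primes
  (\<open>primorial_dvd_funpow_fwd_diff\<close>).

  Analysis: up to the factor \<open>k!\<close>, the \<open>k\<close>-th difference of the samples \<open>G(0), \<dots>, G(k)\<close> is a divided
  difference, that is, a contour integral of \<open>G(z) / (z (z - 1) \<dots> (z - k))\<close>. If \<open>\<bar>G(z)\<bar>\<close> is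
  \<open>O(q\<^bsup>Re z\<^esup>)\<close> on a half-plane, with \<open>q > 2\<close>, the integral around a suitable rectangle shows that the
  difference is \<open>O(k (q - 1)\<^sup>k)\<close>. The hypothesis on \<open>\<rho>\<close> gives \<open>exp \<rho> < 2 \<surd>e < 33/10\<close>, so
  \<open>q = 33/10\<close> works, and the bound is \<open>O(k (23/10)\<^sup>k)\<close> (\<open>funpow_fwd_diff_growth_bound\<close>).

  The product of the primes up to \<open>k\<close> outgrows \<open>(23/10)\<^sup>k\<close> (\<open>primorial_eventually_large\<close>). The prime
  number theorem would give the rate \<open>e\<close>; Chebyshev's elementary method suffices, provided
  that it is run with a factorial ratio better than the central binomial coefficient, whose rate
  is only \<open>2\<close>. The ratio \<open>(12m)! m! / ((6m)! (4m)! (3m)!)\<close> gives the rate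
  \<open>27648\<^bsup>1/12\<^esup> > 2.34\<close>.

  So a nonzero difference of large order is impossible, and Newton's forward formula turns the
  vanishing of these differences into a polynomial. This is first done for a shift of the
  sequence that moves the sample points well inside the half-plane; the finitely many terms before
  them follow because a primary pseudo-polynomial that is eventually zero is zero.

  That \<open>F\<close> is the same polynomial is a uniqueness statement in the spirit of Carlson's theorem. Once
  multiplied by \<open>exp (- \<rho> z)\<close> and divided by a power of \<open>z + 4\<close>, the difference of
  the two functions (with arguments shifted) is bounded on a half-plane and vanishes at all natural
  numbers. The contour integral for the nodes \<open>0, \<dots>, N\<close> and one further point then tends to zero
  (\<open>bounded_vanishing_on_nat_imp_zero\<close>).
\<close>

section \<open>Forward differences and Newton's formula\<close>

definition fwd_diff :: "(nat \<Rightarrow> 'a::comm_ring_1) \<Rightarrow> nat \<Rightarrow> 'a" where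
  "fwd_diff a n = a (Suc n) - a n"

lemma funpow_fwd_diff_Suc: "(fwd_diff ^^ Suc k) a n = (fwd_diff ^^ k) a (Suc n) - (fwd_diff ^^ k) a n"
  by (simp add: fwd_diff_def)

text \<open>
  The sign is written \<open>(-1)\<^bsup>k + j\<^esup>\<close> rather than \<open>(-1)\<^bsup>k - j\<^esup>\<close>, which avoids truncated subtraction.
\<close>

lemma funpow_fwd_diff_eq_sum:
  "(fwd_diff ^^ k) a n = (\<Sum>j\<le>k. (-1)^(k+j) * of_nat (k choose j) * a (n + j))"
proof (induction k arbitrary: n)
  case (Suc k)
  let ?c = "\<lambda>k j. (-1)^(k+j) * of_nat (k choose j) :: 'a"
  have "(\<Sum>j\<le>Suc k. ?c (Suc k) j * a (n + j))
      = ?c (Suc k) 0 * a n + (\<Sum>j\<le>k. ?c (Suc k) (Suc j) * a (n + Suc j))"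
    by (subst sum.atMost_Suc_shift) simp
  also have "(\<Sum>j\<le>k. ?c (Suc k) (Suc j) * a (n + Suc j))
      = (\<Sum>j\<le>k. ?c k j * a (Suc n + j)) - (\<Sum>j\<le>k. ?c k (Suc j) * a (n + Suc j))"
    by (simp add: sum_subtractf [symmetric] algebra_simps flip: sum_negf sum.distrib)
  also have "?c (Suc k) 0 * a n + \<dots> =
      (\<Sum>j\<le>k. ?c k j * a (Suc n + j)) - (?c k 0 * a n + (\<Sum>j\<le>k. ?c k (Suc j) * a (n + Suc j)))"
    by (simp add: algebra_simps)
  also have "?c k 0 * a n + (\<Sum>j\<le>k. ?c k (Suc j) * a (n + Suc j)) = (\<Sum>j\<le>Suc k. ?c k j * a (n + j))"
    by (subst sum.atMost_Suc_shift) simp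
  also have "\<dots> = (\<Sum>j\<le>k. ?c k j * a (n + j))"
    by (simp add: binomial_eq_0)
  finally show ?case
    unfolding funpow_fwd_diff_Suc Suc by simp
qed auto

lemma newton_forward: "a n = (\<Sum>k\<le>n. of_nat (n choose k) * (fwd_diff ^^ k) a 0)"
proof (induction n arbitrary: a)
  case (Suc n)
  let ?d = "\<lambda>k. (fwd_diff ^^ k) a 0"
  have shift: "(fwd_diff ^^ k) (\<lambda>n. a (Suc n)) 0 = ?d k + ?d (Suc k)" for k
  proof -
    have "(fwd_diff ^^ k) (\<lambda>n. a (Suc n)) 0 = (fwd_diff ^^ k) a (Suc 0)"
      by (simp add: funpow_fwd_diff_eq_sum)
    thus ?thesis by (simp only: funpow_fwd_diff_Suc) simp
  qed
  have "a (Suc n) = (\<Sum>k\<le>n. of_nat (n choose k) * (?d k + ?d (Suc k)))"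
    using Suc[of "\<lambda>n. a (Suc n)"] by (simp only: shift)
  also have "\<dots> = (\<Sum>k\<le>Suc n. of_nat (n choose k) * ?d k) + (\<Sum>k\<le>n. of_nat (n choose k) * ?d (Suc k))"
    by (simp add: ring_distribs sum.distrib binomial_eq_0 del: funpow.simps)
  also have "(\<Sum>k\<le>Suc n. of_nat (n choose k) * ?d k)
      = ?d 0 + (\<Sum>k\<le>n. of_nat (n choose Suc k) * ?d (Suc k))"
    by (subst sum.atMost_Suc_shift) (simp del: funpow.simps(2))
  also have "\<dots> + (\<Sum>k\<le>n. of_nat (n choose k) * ?d (Suc k))
      = ?d 0 + (\<Sum>k\<le>n. of_nat (Suc n choose Suc k) * ?d (Suc k))"
    by (simp add: algebra_simps sum.distrib del: funpow.simps(2))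
  also have "\<dots> = (\<Sum>k\<le>Suc n. of_nat (Suc n choose k) * ?d k)"
    by (subst sum.atMost_Suc_shift) (simp del: funpow.simps(2))
  finally show ?case .
qed auto

section \<open>Divisibility of the differences of a primary pseudo-polynomial\<close>

text \<open>
  All inner binomial coefficients of order \<open>p\<close> are divisible by \<open>p\<close>, so only \<open>a (n + p) \<plusminus> a n\<close> is
  left. The sign is a minus for odd \<open>p\<close>, and it does not matter modulo \<open>2\<close>.
\<close>

lemma prime_dvd_funpow_fwd_diff_prime:
  assumes "primary_pseudo_polynomial a" "prime p"
  shows "int p dvd (fwd_diff ^^ p) a n"
proof -
  let ?t = "\<lambda>j. (-1)^(p+j) * int (p choose j) * a (n + j)"
  have p: "p > 0" using assms(2) by (simp add: prime_gt_0_nat)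
  have "{..p} = insert 0 (insert p {0<..<p})" using p by auto
  hence "(fwd_diff ^^ p) a n = ?t 0 + ?t p + (\<Sum>j\<in>{0<..<p}. ?t j)"
    unfolding funpow_fwd_diff_eq_sum using p by (simp add: algebra_simps)
  moreover have "int p dvd (\<Sum>j\<in>{0<..<p}. ?t j)"
  proof (intro dvd_sum dvd_mult2[OF dvd_mult])
    fix j assume "j \<in> {0<..<p}"
    thus "int p dvd int (p choose j)"
      using assms(2) by (subst int_dvd_int_iff, intro dvd_choose_prime) auto
  qed
  moreover have "int p dvd ?t 0 + ?t p"
  proof -
    have c: "int p dvd a (n + p) - a n"
      using assms unfolding primary_pseudo_polynomial_def by (simp add: cong_iff_dvd_diff)
    show ?thesis
    proof (cases "p = 2")
      case True
      have "?t 0 + ?t p = (a (n + p) - a n) + int p * a n" using True by simp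
      thus ?thesis using c by (metis dvd_add dvd_triv_left)
    next
      case False
      hence "odd p" using assms(2) by (metis prime_odd_nat prime_ge_2_nat le_neq_implies_less)
      hence "?t 0 + ?t p = a (n + p) - a n" by simp
      thus ?thesis using c by simp
    qed
  qed
  ultimately show ?thesis by (simp only: dvd_add)
qed

text \<open>
  The \<open>k\<close>-th difference is an integer combination of values of the \<open>p\<close>-th difference.
\<close>

lemma prime_dvd_funpow_fwd_diff:
  assumes "primary_pseudo_polynomial a" "prime p" "p \<le> k"
  shows "int p dvd (fwd_diff ^^ k) a n"
proof -
  have "(fwd_diff ^^ k) a n = (fwd_diff ^^ (k - p)) ((fwd_diff ^^ p) a) n"
    using assms(3) by (simp flip: funpow_add[THEN fun_cong, unfolded o_def])
  also have "int p dvd \<dots>"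
    unfolding funpow_fwd_diff_eq_sum[of "k - p"]
    by (intro dvd_sum dvd_mult prime_dvd_funpow_fwd_diff_prime assms)
  finally show ?thesis .
qed

definition primorial :: "nat \<Rightarrow> nat" where
  "primorial n = \<Prod>{p. prime p \<and> p \<le> n}"

lemma finite_primes_le: "finite {p::nat. prime p \<and> p \<le> n}"
  by (rule finite_subset[of _ "{..n}"]) auto

lemma primorial_mono: "m \<le> n \<Longrightarrow> primorial m \<le> primorial n"
  unfolding primorial_def
  by (intro dvd_imp_le prod_dvd_prod_subset finite_primes_le prod_pos) (auto simp: prime_gt_0_nat)

lemma primorial_dvd_funpow_fwd_diff:
  assumes "primary_pseudo_polynomial a"
  shows "int (primorial k) dvd (fwd_diff ^^ k) a n"
proof -
  have "(\<Prod>p\<in>A. int p) dvd (fwd_diff ^^ k) a n" if "finite A" "A \<subseteq> {p. prime p \<and> p \<le> k}" for A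
    using that
  proof (induction A rule: finite_induct)
    case (insert p A)
    have "coprime (int p) (\<Prod>q\<in>A. int q)"
      using insert by (intro prod_coprime_right) (auto intro!: primes_coprime)
    moreover have "int p dvd (fwd_diff ^^ k) a n"
      using insert assms prime_dvd_funpow_fwd_diff by auto
    ultimately show ?case using insert by (auto intro: divides_mult)
  qed auto
  from this[OF finite_primes_le] show ?thesis
    unfolding primorial_def by simp
qed

lemma primary_pseudo_polynomial_shift:
  "primary_pseudo_polynomial a \<Longrightarrow> primary_pseudo_polynomial (\<lambda>n. a (n + m))"
  unfolding primary_pseudo_polynomial_def by (metis add.commute add.left_commute)

lemma primary_pseudo_polynomial_funpow_fwd_diff:
  "primary_pseudo_polynomial a \<Longrightarrow> primary_pseudo_polynomial ((fwd_diff ^^ k) a)"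
proof (induction k)
  case (Suc k)
  show ?case
    unfolding primary_pseudo_polynomial_def funpow_fwd_diff_Suc
  proof (intro allI impI cong_diff)
    fix n p :: nat assume "prime p"
    thus "[(fwd_diff ^^ k) a (Suc (n + p)) = (fwd_diff ^^ k) a (Suc n)] (mod int p)"
      "[(fwd_diff ^^ k) a (n + p) = (fwd_diff ^^ k) a n] (mod int p)"
      using Suc unfolding primary_pseudo_polynomial_def by (metis add_Suc)+
  qed
qed auto

text \<open>
  The term \<open>a n\<close> is congruent to the later zero \<open>a (n + p)\<close> modulo every large prime \<open>p\<close>, so a prime
  larger than \<open>\<bar>a n\<bar>\<close> divides it.
\<close>

lemma primary_pseudo_polynomial_eventually_zero_imp_zero:
  assumes "primary_pseudo_polynomial a" "\<And>n. n \<ge> m \<Longrightarrow> a n = 0"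
  shows "a n = 0"
proof -
  obtain p where p: "prime p" "p > m + nat \<bar>a n\<bar>"
    using bigger_prime by blast
  have "int p dvd a n"
    using assms p unfolding primary_pseudo_polynomial_def
    by (metis cong_0_iff cong_sym le_add2 less_imp_le_nat order_trans add_leD1)
  moreover have "\<bar>a n\<bar> < int p" using p by linarith
  ultimately show ?thesis using zdvd_not_zless[of "\<bar>a n\<bar>" "int p"] by (cases "a n = 0") auto
qed

section \<open>A Chebyshev bound for the product of the primes\<close>

lemma multiplicity_eq_card:
  fixes p n K :: nat
  assumes "prime p" "0 < n" "n \<le> K"
  shows "multiplicity p n = card {i\<in>{1..K}. p ^ i dvd n}"
proof -
  have "\<not> is_unit p" using assms(1) by (simp add: prime_nat_iff)
  have le: "i \<le> K" if "p ^ i dvd n" for i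
  proof -
    have "i < p ^ i" using prime_gt_1_nat[OF assms(1)] by (simp add: power_gt_expt)
    thus ?thesis using dvd_imp_le[OF that assms(2)] assms(3) by simp
  qed
  have "{i\<in>{1..K}. p ^ i dvd n} = {1..multiplicity p n}"
    using \<open>\<not> is_unit p\<close> assms(2) le
    by (auto simp: power_dvd_iff_le_multiplicity)
  thus ?thesis by simp
qed

text \<open>
  Legendre's formula. The upper summation limit is any \<open>K \<ge> n\<close>, so that the formulas for several
  factorials can be added term by term.
\<close>

lemma multiplicity_fact:
  fixes p n K :: nat
  assumes "prime p" "n \<le> K"
  shows "multiplicity p (fact n) = (\<Sum>i=1..K. n div p ^ i)"
  using assms(2)
proof (induction n)
  case (Suc n)
  have "multiplicity p (fact (Suc n)) = multiplicity p (Suc n * fact n)" by simp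
  also have "\<dots> = multiplicity p (Suc n) + multiplicity p (fact n)"
    using assms(1) by (intro prime_elem_multiplicity_mult_distrib) auto
  also have "multiplicity p (Suc n) = card {i\<in>{1..K}. p ^ i dvd Suc n}"
    using Suc.prems assms(1) by (intro multiplicity_eq_card) auto
  also have "\<dots> = (\<Sum>i=1..K. if p ^ i dvd Suc n then 1 else 0)"
    by (simp add: sum.If_cases Int_def)
  also have "\<dots> + multiplicity p (fact n) = (\<Sum>i=1..K. Suc n div p ^ i)"
    using Suc by (auto simp: div_Suc dvd_eq_mod_eq_0 simp flip: sum.distrib intro!: sum.cong)
  finally show ?case .
qed auto

text \<open>
  All quotients are determined by \<open>t = (12 * m) div q\<close>, and because \<open>1 + 1/12 = 1/2 + 1/3 + 1/4\<close>, the
  two sides differ only by rounding. The rounding errors are at most \<open>1/2 + 2/3 + 3/4 < 2\<close>, so the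
  integer defect is at most \<open>1\<close>, and it is \<open>0\<close> for \<open>t = 0\<close>.
\<close>

lemma chebyshev_floor_inequality:
  fixes m q :: nat
  assumes "q > 0"
  shows "(12 * m) div q + m div q \<le> (6 * m) div q + (4 * m) div q + (3 * m) div q + (if q \<le> 12 * m then 1 else 0)"
proof -
  define t where "t = (12 * m) div q"
  have div: "(12 * m div d) div q = t div d" for d
    unfolding t_def by (metis div_mult2_eq mult.commute)
  have "t \<ge> 1 \<longleftrightarrow> q \<le> 12 * m"
    unfolding t_def using assms by (simp add: Suc_le_eq div_greater_zero_iff)
  moreover have "m div q = t div 12" "6 * m div q = t div 2" "4 * m div q = t div 3" "3 * m div q = t div 4"
    using div[of 12] div[of 2] div[of 3] div[of 4] by simp_all
  moreover have "t + t div 12 \<le> t div 2 + t div 3 + t div 4 + (if t \<ge> 1 then 1 else 0)"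
  proof (cases "t = 0")
    case False
    have "t + t div 12 \<le> t div 2 + t div 3 + t div 4 + 1" by linarith
    thus ?thesis using False by simp
  qed simp
  ultimately show ?thesis by (simp add: t_def)
qed

text \<open>
  For \<open>n \<ge> 1\<close>, this is the largest power of the prime \<open>p\<close> that is at most \<open>n\<close>. Writing the
  exponent as a cardinality matches the sum over \<open>i\<close> in Legendre's formula.
\<close>

definition prime_power_part :: "nat \<Rightarrow> nat \<Rightarrow> nat" where
  "prime_power_part p n = p ^ card {i\<in>{1..n}. p ^ i \<le> n}"

text \<open>
  By Legendre's formula and the floor inequality, each prime \<open>p\<close> has in the ratio of the factorials at
  most the multiplicity given by the number of powers \<open>p\<^sup>i \<le> 12 m\<close>. Stated without division, the
  bound does not presuppose that the ratio is an integer.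
\<close>

lemma fact_ratio_le_prime_powers:
  "fact (12 * m) * fact m \<le> (fact (6 * m) * fact (4 * m) * fact (3 * m) *
     (\<Prod>p | prime p \<and> p \<le> 12 * m. prime_power_part p (12 * m)) :: nat)"
proof (rule dvd_imp_le)
  let ?e = "\<lambda>p. card {i\<in>{1..12*m}. p ^ i \<le> 12 * m}"
  let ?L = "\<Prod>p | prime p \<and> p \<le> 12 * m. prime_power_part p (12 * m)"
  have Lpos: "?L > 0"
    unfolding prime_power_part_def by (intro prod_pos) (auto simp: prime_gt_0_nat)
  show "0 < fact (6 * m) * fact (4 * m) * fact (3 * m) * ?L"
    using Lpos by simp
  show "fact (12 * m) * fact m dvd fact (6 * m) * fact (4 * m) * fact (3 * m) * ?L"
  proof (rule multiplicity_le_imp_dvd)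
    fix p :: nat assume p: "prime p"
    note distrib = prime_elem_multiplicity_mult_distrib[OF prime_imp_prime_elem[OF p]]
    have L: "multiplicity p ?L = ?e p"
    proof (cases "p \<le> 12 * m")
      case True
      have "multiplicity p ?L = multiplicity p (\<Prod>q | prime q \<and> q \<le> 12 * m. q ^ ?e q)"
        by (simp add: prime_power_part_def)
      also have "\<dots> = ?e p"
        using p True by (subst multiplicity_prod_prime_powers) (auto simp: finite_primes_le)
      finally show ?thesis .
    next
      case False
      have "p ^ i > 12 * m" if "i \<ge> 1" for i
        using False that p self_le_power[of p i] by (simp add: prime_ge_1_nat)
      hence "{i\<in>{1..12*m}. p ^ i \<le> 12 * m} = {}" by (auto simp: not_le)
      hence 0: "?e p = 0" by (simp only: card.empty)
      have "multiplicity p (\<Prod>q | prime q \<and> q \<le> 12 * m. q ^ ?e q) = 0"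
        using p False by (subst multiplicity_prod_prime_powers) (auto simp: finite_primes_le)
      thus ?thesis unfolding 0 prime_power_part_def .
    qed
    have e: "?e p = (\<Sum>i=1..12*m. if p ^ i \<le> 12 * m then 1 else 0)"
      by (simp add: sum.If_cases Int_def)
    have "multiplicity p (fact (12 * m) * fact m :: nat) = multiplicity p (fact (12 * m) :: nat) + multiplicity p (fact m :: nat)"
      by (rule distrib) auto
    also have "\<dots> = (\<Sum>i=1..12*m. 12 * m div p ^ i + m div p ^ i)"
      using multiplicity_fact[OF p, of "12*m" "12*m"] multiplicity_fact[OF p, of m "12*m"] by (simp add: sum.distrib)
    also have "\<dots> \<le> (\<Sum>i=1..12*m. 6 * m div p ^ i + 4 * m div p ^ i + 3 * m div p ^ i + (if p ^ i \<le> 12 * m then 1 else 0))"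
      using p by (intro sum_mono chebyshev_floor_inequality) (auto simp: prime_gt_0_nat)
    also have "\<dots> = multiplicity p (fact (6 * m) :: nat) + multiplicity p (fact (4 * m) :: nat)
         + multiplicity p (fact (3 * m) :: nat) + multiplicity p ?L"
    proof -
      have "multiplicity p (fact (6 * m) :: nat) = (\<Sum>i=1..12*m. 6 * m div p ^ i)"
        "multiplicity p (fact (4 * m) :: nat) = (\<Sum>i=1..12*m. 4 * m div p ^ i)"
        "multiplicity p (fact (3 * m) :: nat) = (\<Sum>i=1..12*m. 3 * m div p ^ i)"
        by (rule multiplicity_fact[OF p]; simp)+
      thus ?thesis by (simp only: sum.distrib L e)
    qed
    also have "\<dots> = multiplicity p (fact (6 * m) * fact (4 * m) * fact (3 * m) * ?L)"
      using Lpos by (simp add: distrib)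
    finally show "multiplicity p (fact (12 * m) * fact m :: nat) \<le> multiplicity p (fact (6 * m) * fact (4 * m) * fact (3 * m) * ?L)" .
  qed auto
qed

text \<open>
  A prime above \<open>\<surd>n\<close> contributes itself only, and each of the at most \<open>\<surd>n\<close> smaller primes
  contributes at most \<open>n\<close>. The second factor is subexponential.
\<close>

lemma prod_prime_powers_le_primorial:
  "(\<Prod>p | prime p \<and> p \<le> n. prime_power_part p n) \<le> primorial n * n ^ floor_sqrt n"
proof (cases "n = 0")
  case True
  have "{p. prime p \<and> p \<le> n} = {}" using True by auto
  thus ?thesis unfolding primorial_def by (simp only: prod.empty True) simp
next
  case False
  let ?S = "{..floor_sqrt n}"
  have le: "prime_power_part p n \<le> p * (if p \<in> ?S then n else 1)" if p: "prime p" "p \<le> n" for p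
  proof -
    have p1: "1 \<le> p" by (rule prime_ge_1_nat[OF p(1)])
    show ?thesis
    proof (cases "p \<in> ?S")
      case True
      let ?A = "{i\<in>{1..n}. p ^ i \<le> n}"
      have inj: "card ?A \<le> k" if "\<And>i. p ^ i \<le> n \<Longrightarrow> i \<le> k" for k
        using card_mono[of "{1..k}" ?A] that by (simp add: subset_iff)
      define k where "k = Max {i. p ^ i \<le> n}"
      have "{i. p ^ i \<le> n} \<subseteq> {..n}"
      proof safe
        fix i assume "p ^ i \<le> n"
        moreover have "i < p ^ i" using prime_gt_1_nat[OF p(1)] by (simp add: power_gt_expt)
        ultimately show "i \<le> n" by simp
      qed
      hence fin: "finite {i. p ^ i \<le> n}" by (rule finite_subset) simp
      have "p ^ 0 \<le> n" using False by simp
      hence "{i. p ^ i \<le> n} \<noteq> {}" by blast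
      hence k: "p ^ k \<le> n" "\<And>i. p ^ i \<le> n \<Longrightarrow> i \<le> k"
        using Max_in[OF fin] Max_ge[OF fin] unfolding k_def by blast+
      have "prime_power_part p n \<le> p ^ k"
        unfolding prime_power_part_def using inj[OF k(2)] p by (intro power_increasing) (use p1 in auto)
      also have "\<dots> \<le> n" by (rule k)
      also have "n \<le> p * n" using p1 by simp
      finally show ?thesis using True by simp
    next
      case nS: False
      have "n < p ^ 2" using nS p(1) by (simp add: le_floor_sqrt_iff not_le)
      have "i = 1" if "i \<ge> 1" "p ^ i \<le> n" for i
      proof (rule ccontr)
        assume "i \<noteq> 1"
        hence "p ^ 2 \<le> p ^ i" using that p by (intro power_increasing) (use p1 in auto)
        thus False using \<open>n < p ^ 2\<close> that by simp
      qed
      hence "{i\<in>{1..n}. p ^ i \<le> n} \<subseteq> {1}" by auto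
      hence "card {i\<in>{1..n}. p ^ i \<le> n} \<le> 1" using card_mono[of "{1::nat}"] by force
      hence "prime_power_part p n \<le> p ^ 1"
        unfolding prime_power_part_def using p by (intro power_increasing) (use p1 in auto)
      thus ?thesis unfolding if_not_P[OF nS] by simp
    qed
  qed
  have "(\<Prod>p | prime p \<and> p \<le> n. prime_power_part p n) \<le> (\<Prod>p | prime p \<and> p \<le> n. p * (if p \<in> ?S then n else 1))"
    using le by (intro prod_mono) auto
  also have "\<dots> = primorial n * n ^ card ({p. prime p \<and> p \<le> n} \<inter> ?S)"
    by (simp add: prod.distrib primorial_def prod.If_cases finite_primes_le del: atMost_iff)
  also have "\<dots> \<le> primorial n * n ^ floor_sqrt n"
  proof -
    have "card ({p. prime p \<and> p \<le> n} \<inter> ?S) \<le> card {1..floor_sqrt n}"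
      by (intro card_mono) (auto simp: Suc_le_eq prime_gt_0_nat)
    thus ?thesis using False by (intro mult_left_mono power_increasing) auto
  qed
  finally show ?thesis .
qed

definition fact_ratio :: "nat \<Rightarrow> real" where
  "fact_ratio m = fact (12 * m) * fact m / (fact (6 * m) * fact (4 * m) * fact (3 * m))"

text \<open>
  The quotient of consecutive ratios tends to \<open>24 * 12\<^sup>4 / 18 = 27648\<close>, the twelfth power of the growth
  rate of the primorial that this method yields.
\<close>

lemma fact_ratio_Suc:
  fixes m :: nat
  defines "x \<equiv> real m"
  shows "fact_ratio (Suc m) = 24 * (12 * x + 1) * (12 * x + 5) * (12 * x + 7) * (12 * x + 11) /
      ((2 * x + 1) * (x + 1) * (3 * x + 1) * (3 * x + 2)) * fact_ratio m"
proof -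
  have x: "x \<ge> 0" by (simp add: x_def)
  define A B C D E :: real where "A = fact (12 * m)" "B = fact m" "C = fact (6 * m)" "D = fact (4 * m)" "E = fact (3 * m)"
  note defs = this
  have f12: "fact (12 * Suc m) = 2*(6*x+6) * (12*x+11) * (2*(6*x+5)) * (3*(4*x+3)) * (2*(6*x+4)) * (12*x+7) * (2*(6*x+3))
      * (12*x+5) * (2*(6*x+2)) * (3*(4*x+1)) * (2*(6*x+1)) * (12*x+1) * A"
    by (simp add: numeral_eq_Suc defs x_def) (simp add: algebra_simps)?
  have f6: "fact (6 * Suc m) = (6*x+6) * (6*x+5) * (6*x+4) * (6*x+3) * (6*x+2) * (6*x+1) * C"
    by (simp add: numeral_eq_Suc defs x_def) (simp add: algebra_simps)?
  have f4: "fact (4 * Suc m) = 4*(x+1) * (4*x+3) * (2*(2*x+1)) * (4*x+1) * D"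
    by (simp add: numeral_eq_Suc defs x_def) (simp add: algebra_simps)?
  have f3: "fact (3 * Suc m) = 3*(x+1) * (3*x+2) * (3*x+1) * E"
    by (simp add: numeral_eq_Suc defs x_def) (simp add: algebra_simps)?
  have f1: "fact (Suc m) = (x+1) * B"
    by (simp add: defs x_def)
  \<comment> \<open>The linear factors become variables, since only their cancellation matters.\<close>
  have cancel: "2*a6 * n11 * (2*a5) * (3*b3) * (2*a4) * n7 * (2*a3) * n5 * (2*a2) * (3*b1) * (2*a1) * n1 * A * (y * B)
      / (a6 * a5 * a4 * a3 * a2 * a1 * C * (4*y * b3 * (2*w) * b1 * D) * (3*y * v2 * v1 * E))
      = 24 * n1 * n5 * n7 * n11 / (w * y * v1 * v2) * (A * B / (C * D * E))"
    if "a1 > 0" "a2 > 0" "a3 > 0" "a4 > 0" "a5 > 0" "a6 > 0" "b1 > 0" "b3 > 0" "y > 0" "w > 0" "v1 > 0" "v2 > 0"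
    for a1 a2 a3 a4 a5 a6 b1 b3 y w v1 v2 n1 n5 n7 n11 :: real
    using that by (simp add: divide_simps)
  show ?thesis
    unfolding fact_ratio_def f12 f6 f4 f3 f1 defs[symmetric]
    by (rule cancel) (use x in auto)
qed

text \<open>
  Any constant strictly between \<open>(23/10)\<^sup>1\<^sup>2 < 21915\<close> and the limit \<open>27648\<close> would serve the purpose; the
  value \<open>25000\<close> leaves room on both sides, and is reached early.
\<close>

lemma fact_ratio_growth:
  assumes "m \<ge> 10"
  shows "fact_ratio (Suc m) \<ge> 25000 * fact_ratio m"
proof -
  define x where "x = real m"
  define y where "y = x - 10"
  have y: "y \<ge> 0" "x = y + 10" using assms by (simp_all add: y_def x_def)
  have pos: "(2 * x + 1) * (x + 1) * (3 * x + 1) * (3 * x + 2) > 0" using y by simp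
  \<comment> \<open>Expanded around \<open>x = 10\<close>, all coefficients are positive.\<close>
  have "24 * (12 * x + 1) * (12 * x + 5) * (12 * x + 7) * (12 * x + 11)
      - 25000 * ((2 * x + 1) * (x + 1) * (3 * x + 1) * (3 * x + 2)) =
      310431000 * y ^ 0 + 144671176 * y ^ 1 + 24364880 * y ^ 2 + 1776888 * y ^ 3 + 47664 * y ^ 4"
    unfolding y(2) by algebra
  also have "\<dots> \<ge> 0" using y(1) by simp
  finally have "25000 \<le> 24 * (12 * x + 1) * (12 * x + 5) * (12 * x + 7) * (12 * x + 11) /
      ((2 * x + 1) * (x + 1) * (3 * x + 1) * (3 * x + 2))"
    using pos by (simp add: pos_le_divide_eq)
  moreover have "fact_ratio m \<ge> 0" by (simp add: fact_ratio_def)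
  ultimately show ?thesis
    unfolding fact_ratio_Suc x_def by (rule mult_right_mono)
qed

lemma fact_ratio_lower_bound: "\<exists>c>0. \<forall>m. fact_ratio m \<ge> c * 25000 ^ m"
proof -
  have pos: "fact_ratio m > 0" for m by (simp add: fact_ratio_def)
  define c where "c = Min ((\<lambda>m. fact_ratio m / 25000 ^ m) ` {..10})"
  have c: "c > 0" unfolding c_def using pos by (subst Min_gr_iff) auto
  have "fact_ratio m \<ge> c * 25000 ^ m" if "m \<le> 10" for m
  proof -
    have "c \<le> fact_ratio m / 25000 ^ m" unfolding c_def using that by (intro Min_le) auto
    thus ?thesis by (simp add: pos_le_divide_eq)
  qed
  moreover have "fact_ratio m \<ge> c * 25000 ^ m" if "m \<ge> 10" for m
    using that
  proof (induction m rule: dec_induct)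
    case base
    show ?case by (rule calculation) simp
  next
    case (step m)
    thus ?case using fact_ratio_growth[of m] by simp
  qed
  ultimately show ?thesis using c by (metis nle_le)
qed

lemma fact_ratio_le_primorial:
  "fact_ratio m \<le> real (primorial (12 * m)) * real (12 * m) ^ floor_sqrt (12 * m)"
proof -
  have "fact (12 * m) * fact m \<le> fact (6 * m) * fact (4 * m) * fact (3 * m) *
     (primorial (12 * m) * (12 * m) ^ floor_sqrt (12 * m))"
    using fact_ratio_le_prime_powers[of m] prod_prime_powers_le_primorial[of "12 * m"]
    by (meson mult_le_mono2 order_trans)
  hence "real (fact (12 * m) * fact m) \<le> real (fact (6 * m) * fact (4 * m) * fact (3 * m) *
     (primorial (12 * m) * (12 * m) ^ floor_sqrt (12 * m)))"
    by (simp only: of_nat_le_iff)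
  thus ?thesis
    unfolding fact_ratio_def by (simp add: divide_le_eq mult_ac)
qed

text \<open>
  Since \<open>(23/10)\<^sup>1\<^sup>2 / 25000 < 9/10\<close>, the exponential gain over \<open>m = n div 12\<close> beats the polynomial factor,
  the constant lost in rounding \<open>n\<close> down to \<open>12 m\<close>, and the subexponential factor \<open>(12 m)\<^bsup>\<surd>(12 m)\<^esup>\<close>.
\<close>

lemma primorial_eventually_large:
  fixes K :: real
  shows "\<forall>\<^sub>F n in sequentially. K * (real n + 1) * (23 / 10) ^ n < real (primorial n)"
proof -
  obtain c where c: "c > 0" "\<And>m. fact_ratio m \<ge> c * 25000 ^ m"
    using fact_ratio_lower_bound by blast
  have "(\<lambda>m. (12 * real m + 12) * exp (sqrt (12 * real m) * ln (12 * real m)) * (9/10) ^ m) \<longlonglongrightarrow> 0"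
    by real_asymp
  hence "(\<lambda>m. \<bar>K\<bar> * (23/10) ^ 12 * ((12 * real m + 12) * exp (sqrt (12 * real m) * ln (12 * real m)) * (9/10) ^ m)) \<longlonglongrightarrow> 0"
    by (rule tendsto_mult_right_zero)
  hence "\<forall>\<^sub>F m in sequentially. \<bar>K\<bar> * (23/10) ^ 12 * ((12 * real m + 12) * exp (sqrt (12 * real m) * ln (12 * real m)) * (9/10) ^ m) < c"
    using c(1) by (rule order_tendstoD)
  hence "\<forall>\<^sub>F m in sequentially. \<bar>K\<bar> * (12 * real m + 12) * (23/10) ^ 12 * ((23/10) ^ 12) ^ m < real (primorial (12 * m))"
    using eventually_gt_at_top[of 0]
  proof eventually_elim
    case (elim m)
    let ?e = "exp (sqrt (12 * real m) * ln (12 * real m))"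
    let ?X = "\<bar>K\<bar> * (12 * real m + 12) * (23/10) ^ 12"
    have m: "m > 0" using elim by simp
    have "real (12 * m) ^ floor_sqrt (12 * m) = real (12 * m) powr real (floor_sqrt (12 * m))"
      using m by (simp add: powr_realpow)
    also have "\<dots> \<le> real (12 * m) powr sqrt (12 * m)"
    proof (rule powr_mono)
      have "real ((floor_sqrt (12 * m))\<^sup>2) \<le> real (12 * m)"
        by (subst of_nat_le_iff) (rule floor_sqrt_power2_le)
      thus "real (floor_sqrt (12 * m)) \<le> sqrt (12 * m)"
        by (intro real_le_rsqrt) simp
    qed (use m in linarith)
    also have "\<dots> = ?e" using m by (simp add: powr_def)
    finally have e: "real (12 * m) ^ floor_sqrt (12 * m) \<le> ?e" .
    have "?X * ((23/10) ^ 12) ^ m * ?e \<le> ?X * (9/10 * 25000) ^ m * ?e"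
      by (intro mult_left_mono mult_right_mono power_mono) (auto simp: power_divide)
    also have "\<dots> = \<bar>K\<bar> * (23/10) ^ 12 * ((12 * real m + 12) * ?e * (9/10) ^ m) * 25000 ^ m"
      unfolding power_mult_distrib by (simp only: mult_ac)
    also have "\<dots> < c * 25000 ^ m"
      using elim by (intro mult_strict_right_mono) auto
    also have "\<dots> \<le> fact_ratio m" by (rule c)
    also have "\<dots> \<le> real (primorial (12 * m)) * real (12 * m) ^ floor_sqrt (12 * m)"
      by (rule fact_ratio_le_primorial)
    also have "\<dots> \<le> real (primorial (12 * m)) * ?e"
      using e by (intro mult_left_mono) auto
    finally show ?case by (rule mult_right_less_imp_less) auto
  qed
  then obtain M where M: "\<And>m. m \<ge> M \<Longrightarrow> \<bar>K\<bar> * (12 * real m + 12) * (23/10) ^ 12 * ((23/10) ^ 12) ^ m < real (primorial (12 * m))"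
    unfolding eventually_sequentially by blast
  have "K * (real n + 1) * (23 / 10) ^ n < real (primorial n)" if "n \<ge> 12 * M" for n
  proof -
    define m where "m = n div 12"
    have m: "12 * m \<le> n" "n \<le> 12 * m + 11" "m \<ge> M" unfolding m_def using that by auto
    have "K * (real n + 1) * (23 / 10) ^ n \<le> \<bar>K\<bar> * (12 * real m + 12) * (23/10) ^ (12 * m + 12)"
      using m(1,2) by (intro mult_mono power_increasing mult_nonneg_nonneg) auto
    also have "\<dots> = \<bar>K\<bar> * (12 * real m + 12) * (23/10) ^ 12 * ((23/10) ^ 12) ^ m"
      unfolding power_add power_mult by (simp only: mult_ac)
    also have "\<dots> < real (primorial (12 * m))" by (rule M[OF m(3)])
    also have "\<dots> \<le> real (primorial n)" using primorial_mono[OF m(1)] by simp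
    finally show ?thesis .
  qed
  thus ?thesis unfolding eventually_sequentially by blast
qed

section \<open>From small differences to a polynomial\<close>

lemma binomial_eq_poly:
  "\<exists>B :: rat poly. \<forall>n. poly B (of_nat n) = of_nat (n choose k)"
proof
  show "\<forall>n. poly (smult (1 / fact k) (\<Prod>i<k. [:- of_nat i, 1:])) (of_nat n) = (of_nat (n choose k) :: rat)"
    by (simp add: poly_prod binomial_gbinomial gbinomial_prod_rev lessThan_atLeast0)
qed

lemma is_polynomial_if_fwd_diff_eventually_zero:
  assumes "\<And>k. k \<ge> K \<Longrightarrow> (fwd_diff ^^ k) a 0 = 0"
  shows "is_polynomial a"
proof -
  obtain B :: "nat \<Rightarrow> rat poly" where B: "\<And>k n. poly (B k) (of_nat n) = of_nat (n choose k)"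
    using binomial_eq_poly by metis
  have "of_int (a n) = poly (\<Sum>k<K. smult (of_int ((fwd_diff ^^ k) a 0)) (B k)) (of_nat n)" for n
  proof -
    have "a n = (\<Sum>k\<le>n. of_nat (n choose k) * (fwd_diff ^^ k) a 0)"
      by (rule newton_forward)
    also have "\<dots> = (\<Sum>k<K+n+1. of_nat (n choose k) * (fwd_diff ^^ k) a 0)"
      by (rule sum.mono_neutral_left) (auto simp: binomial_eq_0)
    also have "\<dots> = (\<Sum>k<K. of_nat (n choose k) * (fwd_diff ^^ k) a 0)"
      using assms by (intro sum.mono_neutral_right) auto
    finally show ?thesis by (simp add: poly_sum B mult.commute)
  qed
  thus ?thesis unfolding is_polynomial_def by blast
qed

text \<open>
  Being divisible by the primorials, the differences at \<open>m\<close> are too small to be nonzero from some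
  order \<open>k0\<close> on, so by Newton's formula the \<open>k0\<close>-th difference of \<open>a\<close> is
  zero on \<open>{m..}\<close>. That difference is again a primary pseudo-polynomial, hence zero
  everywhere.
\<close>

lemma is_polynomial_if_fwd_diff_small:
  assumes a: "primary_pseudo_polynomial a"
    and small: "\<And>k. \<bar>real_of_int ((fwd_diff ^^ k) (\<lambda>n. a (n + m)) 0)\<bar> \<le> K * (real k + 1) * (23/10) ^ k"
  shows "is_polynomial a"
proof -
  let ?b = "\<lambda>n. a (n + m)"
  obtain k0 where "\<forall>k\<ge>k0. K * (real k + 1) * (23/10) ^ k < real (primorial k)"
    using primorial_eventually_large[of K] unfolding eventually_sequentially ..
  hence k0: "K * (real k + 1) * (23/10) ^ k < real (primorial k)" if "k \<ge> k0" for k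
    using that by simp
  have b0: "(fwd_diff ^^ k) ?b 0 = 0" if "k \<ge> k0" for k
  proof (rule ccontr)
    assume "(fwd_diff ^^ k) ?b 0 \<noteq> 0"
    moreover have "int (primorial k) dvd (fwd_diff ^^ k) ?b 0"
      by (intro primorial_dvd_funpow_fwd_diff primary_pseudo_polynomial_shift a)
    ultimately have "int (primorial k) \<le> \<bar>(fwd_diff ^^ k) ?b 0\<bar>"
      by (metis dvd_imp_le_int abs_of_nat)
    hence "real (primorial k) \<le> \<bar>real_of_int ((fwd_diff ^^ k) ?b 0)\<bar>"
      by linarith
    thus False using small[of k] k0[OF that] by linarith
  qed
  have zero: "(fwd_diff ^^ k0) a n = 0" for n
  proof (rule primary_pseudo_polynomial_eventually_zero_imp_zero)
    show "primary_pseudo_polynomial ((fwd_diff ^^ k0) a)"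
      by (intro primary_pseudo_polynomial_funpow_fwd_diff a)
    fix n assume "n \<ge> m"
    then obtain j where j: "n = j + m" by (metis add.commute le_Suc_ex)
    have "(fwd_diff ^^ k0) a n = (fwd_diff ^^ k0) ?b j"
      by (simp add: funpow_fwd_diff_eq_sum j add_ac)
    also have "\<dots> = (\<Sum>k\<le>j. of_nat (j choose k) * (fwd_diff ^^ k) ((fwd_diff ^^ k0) ?b) 0)"
      by (rule newton_forward)
    also have "\<dots> = (\<Sum>k\<le>j. of_nat (j choose k) * (fwd_diff ^^ (k + k0)) ?b 0)"
      by (simp add: funpow_add)
    also have "\<dots> = 0" by (intro sum.neutral) (auto simp: b0)
    finally show "(fwd_diff ^^ k0) a n = 0" .
  qed
  have "(fwd_diff ^^ k) a n = 0" if "k \<ge> k0" for k n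
    using that
  proof (induction k arbitrary: n rule: dec_induct)
    case base
    show ?case by (rule zero)
  next
    case (step k)
    show ?case unfolding funpow_fwd_diff_Suc step.IH by simp
  qed
  thus ?thesis by (rule is_polynomial_if_fwd_diff_eventually_zero)
qed

section \<open>Divided differences as contour integrals\<close>

text \<open>
  Induction on the set of nodes: for a new node \<open>x\<close>, split \<open>1 / ((z - s) (s - x))\<close> as
  \<open>(1 / (z - s) - 1 / (x - s)) / (z - x)\<close> and use the induction hypothesis at both \<open>z\<close> and \<open>x\<close>.
\<close>

lemma inverse_prod_partial_fractions:
  fixes z :: "'a::field"
  assumes "finite S" "S \<noteq> {}" "z \<notin> S"
  shows "1 / (\<Prod>s\<in>S. z - s) = (\<Sum>s\<in>S. 1 / ((z - s) * (\<Prod>t\<in>S-{s}. s - t)))"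
  using assms
proof (induction S arbitrary: z rule: finite_ne_induct)
  case (insert x S)
  let ?Q = "\<lambda>s. \<Prod>t\<in>S-{s}. s - t"
  have nz: "z - x \<noteq> 0" "\<And>s. s \<in> S \<Longrightarrow> s - x \<noteq> 0" "\<And>s. s \<in> S \<Longrightarrow> z - s \<noteq> 0"
    using insert by auto
  have Q: "(\<Prod>t\<in>insert x S-{s}. s - t) = (s - x) * ?Q s" if "s \<in> S" for s
  proof -
    have "insert x S - {s} = insert x (S - {s})" using insert that by auto
    thus ?thesis using insert by simp
  qed
  have Qx: "insert x S - {x} = S" using insert by auto
  have "(\<Sum>s\<in>insert x S. 1 / ((z - s) * (\<Prod>t\<in>insert x S-{s}. s - t)))
      = 1 / ((z - x) * (\<Prod>t\<in>S. x - t)) + (\<Sum>s\<in>S. 1 / ((z - s) * ((s - x) * ?Q s)))"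
    using insert by (simp add: Qx Q cong: sum.cong)
  also have "(\<Sum>s\<in>S. 1 / ((z - s) * ((s - x) * ?Q s))) =
      (\<Sum>s\<in>S. (1 / ((z - s) * ?Q s) - 1 / ((x - s) * ?Q s)) / (z - x))"
  proof (intro sum.cong refl)
    fix s assume s: "s \<in> S"
    have "?Q s \<noteq> 0" using insert by simp
    thus "1 / ((z - s) * ((s - x) * ?Q s)) = (1 / ((z - s) * ?Q s) - 1 / ((x - s) * ?Q s)) / (z - x)"
      using nz(1) nz(2,3)[OF s] by (simp add: divide_simps) (auto simp: algebra_simps)
  qed
  also have "\<dots> = (1 / (\<Prod>s\<in>S. z - s) - 1 / (\<Prod>s\<in>S. x - s)) / (z - x)"
    using insert.IH[of z] insert.IH[of x] insert.prems insert.hyps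
    by (simp add: sum_subtractf flip: sum_divide_distrib)
  also have "1 / ((z - x) * C) + (1 / P - 1 / C) / (z - x) = 1 / ((z - x) * P)" for P C
    by (simp add: diff_divide_distrib mult.commute)
  finally show ?case
    by (simp add: prod.insert[OF insert.hyps(1,3)])
qed auto

text \<open>
  Partial fractions reduce this to one application of Cauchy's integral formula per node. The sum over
  the nodes is the divided difference of \<open>g\<close> in Lagrange form.
\<close>

lemma divided_difference_contour:
  fixes g :: "complex \<Rightarrow> complex"
  assumes "finite S" "S \<noteq> {}" "S \<subseteq> box p q"
    and "convex A" "open A" "cbox p q \<subseteq> A" "g holomorphic_on A"
  shows "((\<lambda>z. g z / (\<Prod>s\<in>S. z - s)) has_contour_integral
           2 * pi * \<i> * (\<Sum>s\<in>S. g s / (\<Prod>t\<in>S-{s}. s - t))) (rectpath p q)"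
proof -
  have le: "Re p \<le> Re q" "Im p \<le> Im q"
  proof -
    obtain s where "s \<in> box p q" using assms(2,3) by auto
    thus "Re p \<le> Re q" "Im p \<le> Im q" by (auto simp: in_box_complex_iff)
  qed
  have path: "path_image (rectpath p q) = cbox p q - box p q"
    by (rule path_image_rectpath_cbox_minus_box) (use le in auto)
  have "((\<lambda>z. (1 / (\<Prod>t\<in>S-{s}. s - t)) * (g z / (z - s))) has_contour_integral
         (1 / (\<Prod>t\<in>S-{s}. s - t)) * (2 * pi * \<i> * g s)) (rectpath p q)" if "s \<in> S" for s
  proof (rule has_contour_integral_lmul)
    have "winding_number (rectpath p q) s = 1"
      using that assms by (intro winding_number_rectpath) auto
    moreover have "s \<in> interior A"
      using that assms box_subset_cbox by (force simp: interior_open)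
    ultimately show "((\<lambda>z. g z / (z - s)) has_contour_integral 2 * pi * \<i> * g s) (rectpath p q)"
      using Cauchy_integral_formula_convex_simple[of A g s "rectpath p q"] that assms path by auto
  qed
  from has_contour_integral_sum[OF assms(1) this]
  have "((\<lambda>z. \<Sum>s\<in>S. (1 / (\<Prod>t\<in>S-{s}. s - t)) * (g z / (z - s))) has_contour_integral
      (\<Sum>s\<in>S. (1 / (\<Prod>t\<in>S-{s}. s - t)) * (2 * pi * \<i> * g s))) (rectpath p q)" by simp
  also have "(\<Sum>s\<in>S. (1 / (\<Prod>t\<in>S-{s}. s - t)) * (2 * pi * \<i> * g s)) =
      2 * pi * \<i> * (\<Sum>s\<in>S. g s / (\<Prod>t\<in>S-{s}. s - t))"
    by (simp add: sum_distrib_left mult_ac)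
  finally show ?thesis
  proof (rule has_contour_integral_eq)
    fix z assume "z \<in> path_image (rectpath p q)"
    hence "z \<notin> S" using assms path by auto
    have "(\<Sum>s\<in>S. (1 / (\<Prod>t\<in>S-{s}. s - t)) * (g z / (z - s))) =
      g z * (\<Sum>s\<in>S. 1 / ((z - s) * (\<Prod>t\<in>S-{s}. s - t)))"
      by (simp add: sum_distrib_left mult_ac)
    also have "\<dots> = g z / (\<Prod>s\<in>S. z - s)"
      by (subst inverse_prod_partial_fractions[OF assms(1,2) \<open>z \<notin> S\<close>, symmetric]) simp
    finally show "(\<Sum>s\<in>S. (1 / (\<Prod>t\<in>S-{s}. s - t)) * (g z / (z - s))) = g z / (\<Prod>s\<in>S. z - s)" .
  qed
qed

lemma rectpath_contour_bound:
  fixes f :: "complex \<Rightarrow> complex"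
  assumes "(f has_contour_integral i) (rectpath (Complex l (-T)) (Complex r T))"
    and "l < r" "0 < T"
    and left: "\<And>z. Re z = l \<Longrightarrow> \<bar>Im z\<bar> \<le> T \<Longrightarrow> norm (f z) \<le> B1"
    and right: "\<And>z. Re z = r \<Longrightarrow> \<bar>Im z\<bar> \<le> T \<Longrightarrow> norm (f z) \<le> B2"
    and horiz: "\<And>z. l \<le> Re z \<Longrightarrow> Re z \<le> r \<Longrightarrow> \<bar>Im z\<bar> = T \<Longrightarrow> norm (f z) \<le> B3"
  shows "norm i \<le> 2 * T * (B1 + B2) + 2 * (r - l) * B3"
proof -
  define p1 p2 p3 p4 where "p1 = Complex l (-T)" "p2 = Complex r (-T)" "p3 = Complex r T" "p4 = Complex l T"
  note p = this
  have pos: "0 \<le> B1" "0 \<le> B2" "0 \<le> B3"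
    using left[of "Complex l 0"] right[of "Complex r 0"] horiz[of "Complex l T"] assms(2,3)
    by (auto intro: order_trans[OF norm_ge_zero])
  have rp: "rectpath p1 p3 = linepath p1 p2 +++ linepath p2 p3 +++ linepath p3 p4 +++ linepath p4 p1"
    by (simp add: rectpath_def p Let_def)
  have int: "f contour_integrable_on rectpath p1 p3"
    using assms(1) unfolding p contour_integrable_on_def by auto
  have i: "i = contour_integral (rectpath p1 p3) f"
    using assms(1) unfolding p by (simp add: contour_integral_unique)
  have int': "f contour_integrable_on linepath p1 p2" "f contour_integrable_on linepath p2 p3"
     "f contour_integrable_on linepath p3 p4" "f contour_integrable_on linepath p4 p1"
    using int unfolding rp by auto
  have "norm (contour_integral (linepath p1 p2) f) \<le> B3 * norm (p2 - p1)"
  proof (intro contour_integral_bound_linepath int' pos horiz)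
    fix z assume "z \<in> closed_segment p1 p2"
    thus "l \<le> Re z" "Re z \<le> r" "\<bar>Im z\<bar> = T" using assms(2,3)
      by (auto simp: closed_segment_same_Im p closed_segment_eq_real_ivl)
  qed
  moreover have "norm (contour_integral (linepath p3 p4) f) \<le> B3 * norm (p4 - p3)"
  proof (intro contour_integral_bound_linepath int' pos horiz)
    fix z assume "z \<in> closed_segment p3 p4"
    thus "l \<le> Re z" "Re z \<le> r" "\<bar>Im z\<bar> = T" using assms(2,3)
      by (auto simp: closed_segment_same_Im p closed_segment_eq_real_ivl)
  qed
  moreover have "norm (contour_integral (linepath p2 p3) f) \<le> B2 * norm (p3 - p2)"
  proof (intro contour_integral_bound_linepath int' pos right)
    fix z assume "z \<in> closed_segment p2 p3"
    thus "Re z = r" "\<bar>Im z\<bar> \<le> T" using assms(2,3)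
      by (auto simp: closed_segment_same_Re p closed_segment_eq_real_ivl)
  qed
  moreover have "norm (contour_integral (linepath p4 p1) f) \<le> B1 * norm (p1 - p4)"
  proof (intro contour_integral_bound_linepath int' pos left)
    fix z assume "z \<in> closed_segment p4 p1"
    thus "Re z = l" "\<bar>Im z\<bar> \<le> T" using assms(2,3)
      by (auto simp: closed_segment_same_Re p closed_segment_eq_real_ivl)
  qed
  moreover have "norm (p2 - p1) = r - l" "norm (p4 - p3) = r - l" "norm (p3 - p2) = 2 * T" "norm (p1 - p4) = 2 * T"
    using assms(2,3) by (simp_all add: p cmod_def real_sqrt_mult)
  moreover have "i = contour_integral (linepath p1 p2) f + (contour_integral (linepath p2 p3) f +
      (contour_integral (linepath p3 p4) f + contour_integral (linepath p4 p1) f))"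
    unfolding i rp using int' by simp
  hence "norm i \<le> norm (contour_integral (linepath p1 p2) f) + (norm (contour_integral (linepath p2 p3) f) +
      (norm (contour_integral (linepath p3 p4) f) + norm (contour_integral (linepath p4 p1) f)))"
    by (auto intro!: order_trans[OF norm_triangle_ineq] add_mono)
  ultimately show ?thesis by (simp add: algebra_simps)
qed

text \<open>
  The standard estimate, with separate bounds for the left side, the right side and the horizontal
  sides of the rectangle. The factor \<open>1 / \<pi>\<close> is replaced by \<open>1\<close>.
\<close>

lemma divided_difference_bound:
  fixes g :: "complex \<Rightarrow> complex"
  assumes "finite S" "S \<noteq> {}" "\<And>s. s \<in> S \<Longrightarrow> l < Re s \<and> Re s < r \<and> \<bar>Im s\<bar> < T"
    and "g holomorphic_on {z. Re z > u}" "u < l"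
    and "\<And>z. Re z = l \<Longrightarrow> norm (g z / (\<Prod>s\<in>S. z - s)) \<le> B1"
    and "\<And>z. Re z = r \<Longrightarrow> norm (g z / (\<Prod>s\<in>S. z - s)) \<le> B2"
    and "\<And>z. l \<le> Re z \<Longrightarrow> Re z \<le> r \<Longrightarrow> \<bar>Im z\<bar> = T \<Longrightarrow> norm (g z / (\<Prod>s\<in>S. z - s)) \<le> B3"
  shows "norm (\<Sum>s\<in>S. g s / (\<Prod>t\<in>S-{s}. s - t)) \<le> T * (B1 + B2) + (r - l) * B3"
proof -
  obtain s where "s \<in> S" using assms(2) by auto
  from assms(3)[OF this] have lt: "l < r" "0 < T" by auto
  have pos: "0 \<le> B1" "0 \<le> B2" "0 \<le> B3"
    using assms(6)[of "Complex l 0"] assms(7)[of "Complex r 0"] assms(8)[of "Complex l T"] lt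
    by (auto intro: order_trans[OF norm_ge_zero])
  let ?D = "\<Sum>s\<in>S. g s / (\<Prod>t\<in>S-{s}. s - t)"
  have "((\<lambda>z. g z / (\<Prod>s\<in>S. z - s)) has_contour_integral 2 * pi * \<i> * ?D)
          (rectpath (Complex l (-T)) (Complex r T))"
  proof (rule divided_difference_contour)
    show "S \<subseteq> box (Complex l (-T)) (Complex r T)"
      using assms(3) by (fastforce simp: in_box_complex_iff)
    show "cbox (Complex l (-T)) (Complex r T) \<subseteq> {z. Re z > u}"
      using assms(5) by (auto simp: in_cbox_complex_iff)
  qed (rule assms convex_halfspace_Re_gt open_halfspace_Re_gt)+
  hence "norm (2 * pi * \<i> * ?D) \<le> 2 * T * (B1 + B2) + 2 * (r - l) * B3"
    by (rule rectpath_contour_bound[OF _ lt]) (rule assms; assumption)+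
  hence "pi * norm ?D \<le> T * (B1 + B2) + (r - l) * B3"
    by (simp add: norm_mult algebra_simps)
  moreover have "1 * norm ?D \<le> pi * norm ?D"
    using pi_ge_two by (intro mult_right_mono) auto
  ultimately show ?thesis by simp
qed

section \<open>Differences of a function of exponential growth\<close>

text \<open>
  The \<open>M + 1\<close> probabilities of a binomial distribution sum to \<open>1\<close>, and the hypotheses say that \<open>k\<close> is
  a mode: the quotient of consecutive probabilities is at least \<open>1\<close> before \<open>k\<close> and at most \<open>1\<close> after it.
  This replaces Stirling's formula in the estimate of a Beta-type product of factorials.
\<close>

lemma binomial_mode_lower_bound:
  fixes p :: real
  assumes p: "0 < p" "p < 1"
    and k: "k \<le> M" "k \<le> (M + 1) * p" "(M + 1) * p \<le> k + 1"
  shows "1 \<le> (M + 1) * ((M choose k) * p ^ k * (1 - p) ^ (M - k))"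
proof -
  define t where "t = (\<lambda>j. (M choose j) * p ^ j * (1 - p) ^ (M - j))"
  have ratio: "t (Suc j) * (real (Suc j) * (1 - p)) = t j * (real (M - j) * p)" if "j < M" for j
  proof -
    have "real (Suc j) * (M choose Suc j) = real (M - j) * (M choose j)"
      using binomial_absorb_comp[of M j] binomial_absorption[of j "M"] that
      by (metis Suc_times_binomial_add binomial_absorption mult.commute of_nat_mult)
    note absorb = this
    have pow: "(1 - p) * (1 - p) ^ (M - Suc j) = (1 - p) ^ (M - j)"
      using that by (simp add: Suc_diff_Suc flip: power_Suc)
    have "t (Suc j) * (real (Suc j) * (1 - p)) =
        (real (Suc j) * (M choose Suc j)) * (p * p ^ j) * ((1 - p) * (1 - p) ^ (M - Suc j))"
      by (simp only: t_def power_Suc mult_ac)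
    also have "\<dots> = t j * (real (M - j) * p)"
      unfolding absorb pow by (simp only: t_def mult_ac)
    finally show ?thesis .
  qed
  have t0: "t j \<ge> 0" for j unfolding t_def using p by simp
  have up: "t j \<le> t (Suc j)" if "Suc j \<le> k" for j
  proof -
    have "real (Suc j) \<le> (real M + 1) * p" using that k(2) by linarith
    hence "real (Suc j) * (1 - p) \<le> real (M - j) * p"
      using that k(1) by (simp add: of_nat_diff algebra_simps)
    hence "t (Suc j) * (real (Suc j) * (1 - p)) \<ge> t j * (real (Suc j) * (1 - p))"
      using that k(1) t0 by (subst ratio) (auto intro!: mult_left_mono)
    thus ?thesis using p by simp
  qed
  have down: "t (Suc j) \<le> t j" if "k \<le> j" "j < M" for j
  proof -
    have "(real M + 1) * p \<le> real (Suc j)" using that k(3) by linarith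
    hence "real (M - j) * p \<le> real (Suc j) * (1 - p)"
      using that by (simp add: of_nat_diff algebra_simps)
    hence "t (Suc j) * (real (Suc j) * (1 - p)) \<le> t j * (real (Suc j) * (1 - p))"
      using that t0 by (subst ratio) (auto intro!: mult_left_mono)
    thus ?thesis using p by simp
  qed
  have "t j \<le> t k" if "j \<le> M" for j
  proof (cases "j \<le> k")
    case True
    thus ?thesis
    proof (induction j rule: inc_induct)
      case (step j)
      thus ?case using up[of j] by simp
    qed auto
  next
    case False
    hence "k \<le> j" by simp
    thus ?thesis using that
    proof (induction j rule: dec_induct)
      case (step j)
      thus ?case using down[of j] by simp
    qed auto
  qed
  hence "(\<Sum>j\<le>M. t j) \<le> (\<Sum>j\<le>M. t k)" by (intro sum_mono) auto
  moreover have "(\<Sum>j\<le>M. t j) = 1"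
    using binomial_ring[of p "1 - p" M] unfolding t_def by simp
  ultimately show ?thesis unfolding t_def by (simp add: add.commute)
qed

lemma prod_atMost_descending: "(\<Prod>j\<le>n. real (n + 1 + k - j)) = fact (n + 1 + k) / fact k"
proof (induction n)
  case (Suc n)
  have "(\<Prod>j\<le>Suc n. real (Suc n + 1 + k - j)) = real (n + 2 + k) * (\<Prod>j\<le>n. real (n + 1 + k - j))"
    by (subst prod.atMost_Suc_shift) simp
  thus ?case using Suc by simp
qed simp

lemma prod_atMost_ascending: "(\<Prod>j\<le>n. real (j + 1)) = fact (n + 1)"
  by (induction n) (auto simp: algebra_simps)

text \<open>
  The denominator of the Lagrange form for the nodes \<open>0, \<dots>, n\<close>; together with the factor \<open>n!\<close> it gives
  a signed binomial coefficient.
\<close>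

lemma prod_diff_nodes:
  assumes "j \<le> n"
  shows "(\<Prod>t\<in>of_nat ` {..n} - {of_nat j}. of_nat j - t :: complex) = (-1) ^ (n + j) * fact j * fact (n - j)"
proof -
  have "(\<Prod>t\<in>of_nat ` {..n} - {of_nat j}. of_nat j - t :: complex) = (\<Prod>i\<in>{..n}-{j}. of_nat j - of_nat i)"
    by (rule prod.reindex_bij_witness[of _ of_nat "nat \<circ> floor \<circ> Re"]) auto
  also have "{..n} - {j} = {..<j} \<union> {j<..n}" using assms by auto
  also have "(\<Prod>i\<in>{..<j} \<union> {j<..n}. of_nat j - of_nat i :: complex) =
      (\<Prod>i<j. of_nat j - of_nat i) * (\<Prod>i\<in>{j<..n}. of_nat j - of_nat i)"
    by (rule prod.union_disjoint) auto
  also have "(\<Prod>i<j. of_nat j - of_nat i :: complex) = fact j"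
    unfolding fact_prod_rev of_nat_prod lessThan_atLeast0 by (intro prod.cong) (auto simp: of_nat_diff)
  also have "(\<Prod>i\<in>{j<..n}. of_nat j - of_nat i :: complex) = (\<Prod>i\<in>{1..n-j}. (-1) * of_nat i)"
    by (rule prod.reindex_bij_witness[of _ "\<lambda>i. i + j" "\<lambda>i. i - j"]) auto
  also have "\<dots> = (-1) ^ (n - j) * fact (n - j)"
    by (simp only: prod.distrib prod_constant card_atLeastAtMost fact_prod of_nat_prod) simp
  also have "(-1 :: complex) ^ (n - j) = (-1) ^ (n + j)"
    using assms by (simp add: minus_one_power_iff)
  finally show ?thesis by (simp add: mult_ac)
qed

lemma funpow_fwd_diff_eq_divided_difference:
  fixes G :: "complex \<Rightarrow> complex"
  defines "S \<equiv> \<lambda>n. of_nat ` {..n}"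
  shows "(fwd_diff ^^ n) (\<lambda>j. G (of_nat j)) 0 = fact n * (\<Sum>s\<in>S n. G s / (\<Prod>t\<in>S n-{s}. s - t))"
proof -
  have "(\<Sum>s\<in>S n. G s / (\<Prod>t\<in>S n-{s}. s - t)) =
      (\<Sum>j\<le>n. G (of_nat j) / ((-1) ^ (n + j) * fact j * fact (n - j)))"
    unfolding S_def by (subst sum.reindex) (auto simp: inj_on_def prod_diff_nodes)
  also have "fact n * \<dots> = (\<Sum>j\<le>n. (-1)^(n+j) * of_nat (n choose j) * G (of_nat (0 + j)))"
    unfolding sum_distrib_left
  proof (intro sum.cong refl)
    fix j assume "j \<in> {..n}"
    hence "of_nat (n choose j) = (fact n / (fact j * fact (n - j)) :: complex)"
      by (intro binomial_fact) auto
    moreover have "1 / (-1) ^ (n + j) = ((-1) ^ (n + j) :: complex)"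
      by (simp add: minus_one_power_iff)
    ultimately show "fact n * (G (of_nat j) / ((-1) ^ (n + j) * fact j * fact (n - j)))
       = (-1)^(n+j) * of_nat (n choose j) * G (of_nat (0 + j))"
      by (simp add: field_simps minus_one_power_iff)
  qed
  finally show ?thesis by (simp add: funpow_fwd_diff_eq_sum)
qed

lemma norm_prod_nat_nodes_ge:
  fixes z :: complex
  assumes "\<And>j. j \<le> n \<Longrightarrow> 0 \<le> d j" "\<And>j. j \<le> n \<Longrightarrow> d j \<le> norm (z - of_nat j)"
  shows "(\<Prod>j\<le>n. d j) \<le> norm (\<Prod>s\<in>of_nat ` {..n}. z - s)"
proof -
  have "(\<Prod>s\<in>of_nat ` {..n}. z - s) = (\<Prod>j\<le>n. z - of_nat j)"
    by (subst prod.reindex) (auto simp: inj_on_def)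
  thus ?thesis using assms by (auto simp: prod_norm [symmetric] intro!: prod_mono)
qed

text \<open>
  The contour is the rectangle with left side on \<open>Re z = -1\<close>, right side on \<open>Re z = r = n + 1 + k\<close> and height
  of order \<open>n\<close>. On the left the integrand is bounded after multiplication by \<open>n!\<close>, and on the horizontal
  sides the height compensates the growth of \<open>G\<close>. The right side carries the main term
  \<open>(33/10)\<^sup>r n! k! / (n + k + 1)!\<close>. It is smallest where \<open>(33/10) (r - n)\<close> is about \<open>r\<close>, that is, for \<open>k\<close>
  near \<open>10 n / 23\<close>. There the quotient of factorials is at most \<open>(10/33)\<^sup>k (23/33)\<^sup>n\<close>, because \<open>k\<close> is the
  mode of the binomial distribution with parameters \<open>n + k\<close> and \<open>10/33\<close>, and the powers combine to a
  multiple of \<open>(23/10)\<^sup>n\<close>.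
\<close>

lemma funpow_fwd_diff_growth_bound:
  fixes G :: "complex \<Rightarrow> complex"
  assumes G: "G holomorphic_on {z. Re z > -3}"
    and bound: "\<And>z. Re z > -3 \<Longrightarrow> norm (G z) \<le> c * (33/10) powr Re z"
  shows "norm ((fwd_diff ^^ n) (\<lambda>j. G (of_nat j)) 0) \<le> 50 * c * (real n + 1) * (23/10) ^ n"
proof -
  define S where "S = (of_nat ` {..n} :: complex set)"
  define k where "k = 10 * n div 23"
  define r where "r = n + 1 + k"
  \<comment> \<open>On the contour \<open>G\<close> is \<open>O((33/10)\<^bsup>2 n\<^esup>)\<close>, and \<open>11 > (33/10)\<^sup>2\<close>.\<close>
  define T where "T = 11 * (real n + 1)"
  define B1 B2 B3 where "B1 = c / fact n" "B2 = c * (33/10) ^ r / (fact r / fact k)" "B3 = c * (33/10) ^ r / T ^ (n + 1)"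
  note B = this
  have k: "23 * k \<le> 10 * n" "10 * n \<le> 23 * k + 22" unfolding k_def by linarith+
  have r: "n < r" "r \<le> 2 * n + 1" using k(1) unfolding r_def by linarith+
  have T: "T > 0" by (simp add: T_def)
  have c: "c \<ge> 0" using order_trans[OF norm_ge_zero bound[of 0]] by simp
  have Gn: "norm (G z) \<le> c * (33/10) ^ r" if "-1 \<le> Re z" "Re z \<le> r" for z
  proof -
    have "norm (G z) \<le> c * (33/10) powr Re z" using bound that by simp
    also have "\<dots> \<le> c * (33/10) powr real r" using that c by (intro mult_left_mono powr_mono) auto
    finally show ?thesis by (simp add: powr_realpow)
  qed
  have "norm (\<Sum>s\<in>S. G s / (\<Prod>t\<in>S-{s}. s - t)) \<le> T * (B1 + B2) + (real r - (-1)) * B3"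
  proof (rule divided_difference_bound[OF _ _ _ G])
    show "- 1 < Re s \<and> Re s < real r \<and> \<bar>Im s\<bar> < T" if "s \<in> S" for s
      using that r(1) T by (auto simp: S_def)
  next
    fix z assume z: "Re z = - 1"
    have "norm (G z) \<le> c * (33/10) powr (-1)" using bound[of z] z by simp
    also have "\<dots> \<le> c" using c by (simp add: powr_minus)
    finally have 1: "norm (G z) \<le> c" .
    have "(\<Prod>j\<le>n. real (j + 1)) \<le> norm (\<Prod>s\<in>S. z - s)"
      unfolding S_def
    proof (rule norm_prod_nat_nodes_ge)
      fix j show "real (j + 1) \<le> norm (z - of_nat j)"
        using abs_Re_le_cmod[of "z - of_nat j"] z by simp
    qed auto
    moreover have "fact n \<le> (fact (n + 1) :: real)" by (rule fact_mono) simp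
    ultimately have "fact n \<le> norm (\<Prod>s\<in>S. z - s)"
      unfolding prod_atMost_ascending by linarith
    thus "norm (G z / (\<Prod>s\<in>S. z - s)) \<le> B1"
      unfolding B norm_divide using 1 c by (intro frac_le) auto
  next
    fix z assume z: "Re z = real r"
    have "(\<Prod>j\<le>n. real (n + 1 + k - j)) \<le> norm (\<Prod>s\<in>S. z - s)"
      unfolding S_def
    proof (rule norm_prod_nat_nodes_ge)
      fix j assume "j \<le> n"
      thus "real (n + 1 + k - j) \<le> norm (z - of_nat j)"
        using abs_Re_le_cmod[of "z - of_nat j"] z by (simp add: r_def of_nat_diff)
    qed auto
    hence "fact r / fact k \<le> norm (\<Prod>s\<in>S. z - s)"
      unfolding prod_atMost_descending by (simp add: r_def)
    thus "norm (G z / (\<Prod>s\<in>S. z - s)) \<le> B2"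
      unfolding B norm_divide using Gn[of z] z c by (intro frac_le) auto
  next
    fix z assume z: "- 1 \<le> Re z" "Re z \<le> real r" "\<bar>Im z\<bar> = T"
    have "(\<Prod>j\<le>n. T) \<le> norm (\<Prod>s\<in>S. z - s)"
      unfolding S_def
    proof (rule norm_prod_nat_nodes_ge)
      fix j show "T \<le> norm (z - of_nat j)"
        using abs_Im_le_cmod[of "z - of_nat j"] z by simp
    qed (use T in auto)
    thus "norm (G z / (\<Prod>s\<in>S. z - s)) \<le> B3"
      unfolding B norm_divide using Gn[OF z(1,2)] T c by (intro frac_le) auto
  qed (auto simp: S_def)
  hence *: "norm ((fwd_diff ^^ n) (\<lambda>j. G (of_nat j)) 0) \<le> fact n * (T * (B1 + B2) + (real r - (-1)) * B3)"
    unfolding funpow_fwd_diff_eq_divided_difference S_def[symmetric] norm_mult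
    by (simp add: S_def)
  have B1: "fact n * B1 \<le> c" by (simp add: B)
  have B2: "fact n * B2 \<le> c * (33/10) * (23/10) ^ n"
  proof -
    have "1 \<le> (real (n + k) + 1) * (((n + k) choose k) * (10/33) ^ k * (1 - 10/33) ^ (n + k - k))"
      using k by (intro binomial_mode_lower_bound) auto
    also have "real ((n + k) choose k) = fact (n + k) / (fact k * fact n)"
      by (subst binomial_fact) auto
    also have "(real (n + k) + 1) * (fact (n + k) / (fact k * fact n) * (10/33) ^ k * (1 - 10/33) ^ (n + k - k))
       = fact r / (fact k * fact n) * ((10/33) ^ k * (23/33) ^ n)"
      by (simp add: r_def algebra_simps)
    finally have "fact n / (fact r / fact k) \<le> (10/33) ^ k * (23/33::real) ^ n"
      by (simp add: field_simps)
    hence "c * (33/10) ^ r * (fact n / (fact r / fact k)) \<le> c * (33/10) ^ r * ((10/33) ^ k * (23/33) ^ n)"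
      using c by (intro mult_left_mono) auto
    also have "c * (33/10) ^ r * (fact n / (fact r / fact k)) = fact n * B2"
      by (simp add: B)
    finally have "fact n * B2 \<le> c * (33/10) ^ r * ((10/33) ^ k * (23/33) ^ n)" .
    also have "\<dots> = c * (33/10) * ((33/10) ^ k * (10/33) ^ k) * ((33/10) ^ n * (23/33) ^ n)"
      by (simp only: r_def power_add power_one_right mult_ac)
    also have "\<dots> = c * (33/10) * (23/10) ^ n"
      by (simp flip: power_mult_distrib)
    finally show ?thesis .
  qed
  have B3: "fact n * B3 \<le> c"
  proof -
    have "fact n * (33/10) ^ r \<le> real (n ^ n) * (33/10) ^ (2 * n + 1)"
      using r(2) fact_le_power[of n, where 'a = real] by (intro mult_mono power_increasing) auto
    also have "\<dots> = (33/10) * (real n * (33/10)^2) ^ n"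
      by (simp add: power_mult_distrib power_mult)
    also have "\<dots> \<le> T * T ^ n"
    proof -
      have "33/10 \<le> T" "real n * (33/10)\<^sup>2 \<le> T" by (auto simp: T_def power2_eq_square)
      thus ?thesis using T by (intro mult_mono power_mono) auto
    qed
    finally have "fact n * (33/10) ^ r / T ^ (n + 1) \<le> 1"
      using T by (simp add: divide_le_eq)
    from mult_left_mono[OF this c] show ?thesis by (simp add: B mult_ac)
  qed
  have "fact n * (T * (B1 + B2) + (real r - (-1)) * B3) = T * (fact n * B1 + fact n * B2) + (real r + 1) * (fact n * B3)"
    by (simp add: algebra_simps)
  also have "\<dots> \<le> T * (c + c * (33/10) * (23/10) ^ n) + (real r + 1) * c"
    using T B1 B2 B3 by (intro add_mono mult_left_mono) auto
  also have "\<dots> \<le> T * (c * (23/10) ^ n + c * (33/10) * (23/10) ^ n) + (2 * (real n + 1)) * (c * (23/10) ^ n)"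
    using T c r(2) by (intro add_mono mult_left_mono mult_mono) (auto simp: mult_le_cancel_left1)
  also have "\<dots> = (493/10) * (c * (real n + 1) * (23/10) ^ n)"
    by (simp add: T_def field_simps)
  also have "\<dots> \<le> 50 * (c * (real n + 1) * (23/10) ^ n)"
    using c by (intro mult_right_mono) auto
  finally have "fact n * (T * (B1 + B2) + (real r - (-1)) * B3) \<le> 50 * (c * (real n + 1) * (23/10) ^ n)" .
  with * have "norm ((fwd_diff ^^ n) (\<lambda>j. G (of_nat j)) 0) \<le> 50 * (c * (real n + 1) * (23/10) ^ n)"
    by (rule order_trans)
  thus ?thesis by (simp only: mult.assoc)
qed

section \<open>Uniqueness of the interpolating function\<close>

text \<open>
  For \<open>0 < x < 1\<close>, the divided difference of \<open>g\<close> for the nodes \<open>x, 0, \<dots>, N\<close> reduces to the term of \<open>x\<close>,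
  which is at least \<open>\<bar>g x\<bar> / N!\<close> in modulus. On the left side \<open>Re z = -2\<close> of the contour the
  denominator is at least \<open>(N + 2)!\<close>, and two factors more than \<open>N!\<close> are just enough to beat the height
  \<open>N + 1\<close>; the other sides are at distance at least \<open>N + 1\<close> from all nodes. So \<open>g\<close> vanishes on \<open>(0, 1)\<close>,
  and the identity theorem gives the rest.
\<close>

lemma bounded_vanishing_on_nat_imp_zero:
  fixes g :: "complex \<Rightarrow> complex"
  assumes g: "g holomorphic_on {z. Re z > -3}"
    and bound: "\<And>z. Re z > -3 \<Longrightarrow> norm (g z) \<le> B"
    and zero: "\<And>n::nat. g (of_nat n) = 0"
    and w: "Re w > -3"
  shows "g w = 0"
proof -
  have B: "B \<ge> 0" using order_trans[OF norm_ge_zero bound[of 0]] by simp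
  have gx: "g (of_real x) = 0" if x: "0 < x" "x < 1" for x :: real
  proof -
    have le: "norm (g (of_real x)) \<le> 6 * B / (real N + 1)" for N :: nat
    proof -
      let ?x = "complex_of_real x"
      let ?A = "of_nat ` {..N} :: complex set"
      define S where "S = insert ?x ?A"
      define T where "T = real N + 1"
      define B1 B2 where "B1 = B / fact (N + 2)" "B2 = B / T ^ (N + 2)"
      note B12 = this
      have T: "T > 0" by (simp add: T_def)
      have xA: "?x \<notin> ?A"
      proof
        assume "?x \<in> ?A"
        then obtain j where "?x = of_nat j" by auto
        hence "x = real j" by (metis Re_complex_of_real complex_Re_of_nat)
        thus False using x by simp
      qed
      have prodS: "norm (\<Prod>s\<in>S. z - s) = norm (z - ?x) * norm (\<Prod>s\<in>?A. z - s)" for z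
        unfolding S_def using xA by (simp add: norm_mult)
      have far: "norm (g z / (\<Prod>s\<in>S. z - s)) \<le> B2"
        if "Re z > -3" "T \<le> norm (z - ?x)" "\<And>j. j \<le> N \<Longrightarrow> T \<le> norm (z - of_nat j)" for z
      proof -
        have "(\<Prod>j\<le>N. T) \<le> norm (\<Prod>s\<in>?A. z - s)"
          using that(3) T by (intro norm_prod_nat_nodes_ge) auto
        hence "T * T ^ (N + 1) \<le> norm (\<Prod>s\<in>S. z - s)"
          unfolding prodS using that(2) T by (intro mult_mono) auto
        thus ?thesis unfolding norm_divide B12 using bound[OF that(1)] T B by (intro frac_le) auto
      qed
      have "norm (\<Sum>s\<in>S. g s / (\<Prod>t\<in>S-{s}. s - t)) \<le> T * (B1 + B2) + (2 * T - (-2)) * B2"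
      proof (rule divided_difference_bound[OF _ _ _ g])
        show "- 2 < Re s \<and> Re s < 2 * T \<and> \<bar>Im s\<bar> < T" if "s \<in> S" for s
          using that x by (auto simp: S_def T_def)
      next
        fix z assume z: "Re z = -2"
        have "(\<Prod>j\<le>N. real (j + 2)) = fact (N + 2)"
          by (induction N) (auto simp: algebra_simps)
        moreover have "(\<Prod>j\<le>N. real (j + 2)) \<le> norm (\<Prod>s\<in>?A. z - s)"
        proof (rule norm_prod_nat_nodes_ge)
          fix j show "real (j + 2) \<le> norm (z - of_nat j)"
            using abs_Re_le_cmod[of "z - of_nat j"] z by simp
        qed auto
        moreover have "1 \<le> norm (z - ?x)"
          using abs_Re_le_cmod[of "z - ?x"] z x by simp
        ultimately have "1 * fact (N + 2) \<le> norm (\<Prod>s\<in>S. z - s)"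
          unfolding prodS by (intro mult_mono) auto
        thus "norm (g z / (\<Prod>s\<in>S. z - s)) \<le> B1"
          unfolding norm_divide B12 using bound[of z] z B by (intro frac_le) auto
      next
        fix z assume z: "Re z = 2 * T"
        have "T \<le> norm (z - ?x)"
          using abs_Re_le_cmod[of "z - ?x"] z x by (simp add: T_def)
        moreover have "T \<le> norm (z - of_nat j)" if "j \<le> N" for j
          using abs_Re_le_cmod[of "z - of_nat j"] z that by (simp add: T_def)
        ultimately show "norm (g z / (\<Prod>s\<in>S. z - s)) \<le> B2"
          using z T by (intro far) auto
      next
        fix z assume z: "- 2 \<le> Re z" "Re z \<le> 2 * T" "\<bar>Im z\<bar> = T"
        have "T \<le> norm (z - ?x)"
          using abs_Im_le_cmod[of "z - ?x"] z by simp
        moreover have "T \<le> norm (z - of_nat j)" if "j \<le> N" for j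
          using abs_Im_le_cmod[of "z - of_nat j"] z by simp
        ultimately show "norm (g z / (\<Prod>s\<in>S. z - s)) \<le> B2"
          using z by (intro far) auto
      qed (auto simp: S_def)
      also have "(\<Sum>s\<in>S. g s / (\<Prod>t\<in>S-{s}. s - t)) = g ?x / (\<Prod>t\<in>?A. ?x - t)"
      proof -
        have "S - {?x} = ?A" using xA by (auto simp: S_def)
        moreover have "(\<Sum>s\<in>?A. g s / (\<Prod>t\<in>S-{s}. s - t)) = 0"
          using zero by (intro sum.neutral) auto
        ultimately show ?thesis using xA by (simp add: S_def)
      qed
      also have "norm \<dots> = norm (g ?x) / norm (\<Prod>t\<in>?A. ?x - t)"
        by (simp add: norm_divide)
      finally have "norm (g ?x) \<le> norm (\<Prod>t\<in>?A. ?x - t) * (T * B1 + (3 * T + 2) * B2)"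
        using xA by (simp add: pos_divide_le_eq algebra_simps)
      moreover have "norm (\<Prod>t\<in>?A. ?x - t) \<le> fact N"
      proof -
        have "(\<Prod>t\<in>?A. ?x - t) = of_real (\<Prod>j\<le>N. x - real j)"
          by (subst prod.reindex) (auto simp: inj_on_def)
        hence "norm (\<Prod>t\<in>?A. ?x - t) = (\<Prod>j\<le>N. \<bar>x - real j\<bar>)"
          by (simp only: norm_of_real abs_prod)
        also have "\<dots> \<le> (\<Prod>j\<le>N. if j = 0 then 1 else real j)"
          using x by (intro prod_mono) auto
        also have "\<dots> = fact N"
          by (induction N) auto
        finally show ?thesis .
      qed
      moreover have "T * B1 + (3 * T + 2) * B2 \<ge> 0"
        using T B by (simp add: B12)
      ultimately have "norm (g ?x) \<le> fact N * (T * B1 + (3 * T + 2) * B2)"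
        by (meson mult_right_mono order_trans)
      also have "\<dots> = T * (fact N * B1) + (3 * T + 2) * (fact N * B2)"
        by (simp add: algebra_simps)
      also have "\<dots> \<le> T * (B / (T * (T + 1))) + (3 * T + 2) * (B / T ^ 2)"
      proof (intro add_mono mult_left_mono)
        have "fact (N + 2) = T * (T + 1) * fact N" by (simp add: T_def algebra_simps)
        thus "fact N * B1 \<le> B / (T * (T + 1))" unfolding B12 by simp
      next
        have "fact N \<le> T ^ N"
          using fact_le_power[of N, where 'a = real] power_mono[of "real N" T N] by (simp add: T_def)
        from mult_left_mono[OF this B] show "fact N * B2 \<le> B / T ^ 2"
          unfolding B12 using T by (simp add: field_simps power_add power2_eq_square)
      qed (use T in auto)
      also have "T * (B / (T * (T + 1))) + (3 * T + 2) * (B / T ^ 2) \<le> 6 * B / T"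
      proof -
        have "T * (B / (T * (T + 1))) \<le> B / T"
          using T B by (simp add: frac_le)
        moreover have "(3 * T + 2) * (B / T ^ 2) \<le> (5 * T) * (B / T ^ 2)"
          using B T by (intro mult_right_mono) (auto simp: T_def)
        ultimately show ?thesis using T by (simp add: power2_eq_square)
      qed
      finally show ?thesis by (simp only: T_def)
    qed
    have "(\<lambda>N. 6 * B / (real N + 1)) \<longlonglongrightarrow> 0"
      by real_asymp
    hence "norm (g (of_real x)) \<le> 0"
      by (rule LIMSEQ_le_const) (use le in auto)
    thus ?thesis by simp
  qed
  have "(1/2 :: complex) islimpt of_real ` {0<..<1::real}"
    unfolding islimpt_approachable
  proof (intro allI impI)
    fix e :: real assume e: "e > 0"
    define d where "d = min (e/2) (1/4)"
    have d: "0 < d" "d < 1/2" "d < e" using e by (auto simp: d_def)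
    have "complex_of_real (1/2 + d) - 1/2 = of_real d" by simp
    hence "dist (complex_of_real (1/2 + d)) (1/2) = d"
      unfolding dist_norm using d by (simp only: norm_of_real)
    moreover from this have "complex_of_real (1/2 + d) \<noteq> 1/2"
      using d by (metis dist_self less_irrefl)
    ultimately show "\<exists>x'\<in>complex_of_real ` {0<..<1}. x' \<noteq> 1/2 \<and> dist x' (1/2) < e"
      using d by (intro bexI[of _ "complex_of_real (1/2 + d)"]) (auto intro!: imageI simp del: of_real_add)
  qed
  thus "g w = 0"
    by (rule analytic_continuation[OF g open_halfspace_Re_gt convex_connected[OF convex_halfspace_Re_gt], rotated 2])
       (use gx w in auto)
qed

lemma poly_map_of_rat_of_nat:
  "poly (map_poly of_rat P) (of_nat n :: 'a::field_char_0) = of_rat (poly P (of_nat n))"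
  by (induction P) (simp_all add: map_poly_pCons of_rat_add of_rat_mult)

lemma norm_poly_le_power:
  fixes q :: "complex poly"
  assumes "norm w \<ge> 1"
  shows "norm (poly q w) \<le> (\<Sum>i\<le>degree q. norm (coeff q i)) * norm w ^ degree q"
proof -
  have "norm (poly q w) \<le> (\<Sum>i\<le>degree q. norm (coeff q i * w ^ i))"
    unfolding poly_altdef by (rule norm_sum)
  also have "\<dots> \<le> (\<Sum>i\<le>degree q. norm (coeff q i) * norm w ^ degree q)"
    using assms by (intro sum_mono) (auto simp: norm_mult norm_power intro!: mult_left_mono power_increasing)
  finally show ?thesis by (simp add: sum_distrib_right)
qed

text \<open>
  The polynomial is not bounded on vertical lines, so besides the factor \<open>exp (- \<rho> z)\<close> a power of \<open>z + 4\<close>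
  is needed, which has modulus at least \<open>1\<close> on the half-plane.
\<close>

lemma exp_growth_interpolates_poly_imp_eq:
  fixes G :: "complex \<Rightarrow> complex" and q :: "complex poly"
  assumes G: "G holomorphic_on {z. Re z > -3}"
    and bound: "\<And>z. Re z > -3 \<Longrightarrow> norm (G z) \<le> c * exp (\<rho> * Re z)"
    and "\<rho> \<ge> 0"
    and interp: "\<And>n::nat. G (of_nat n) = poly q (of_nat n)"
    and w: "Re w > -3"
  shows "G w = poly q w"
proof -
  define q' where "q' = pcompose q [:-4, 1:]"
  define d where "d = degree q'"
  define C where "C = (\<Sum>i\<le>d. norm (coeff q' i))"
  have q': "poly q' (z + 4) = poly q z" for z by (simp add: q'_def poly_pcompose)
  define h where "h z = (G z - poly q z) * exp (- of_real \<rho> * z) / (z + 4) ^ d" for z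
  have nz: "norm (z + 4) \<ge> 1" if "Re z > -3" for z
    using that abs_Re_le_cmod[of "z + 4"] by simp
  have nz': "z + 4 \<noteq> 0" if "Re z > -3" for z
    using nz[OF that] by auto
  have "h w = 0"
  proof (rule bounded_vanishing_on_nat_imp_zero[of h "c + C * exp (3 * \<rho>)"])
    show "h holomorphic_on {z. Re z > -3}"
      unfolding h_def using nz' by (intro holomorphic_intros G) auto
  next
    fix z :: complex assume z: "Re z > -3"
    have c: "c \<ge> 0" using order_trans[OF norm_ge_zero bound[of 0]] by simp
    have C: "C \<ge> 0" unfolding C_def by (intro sum_nonneg) auto
    have D: "norm (z + 4) ^ d \<ge> 1" using nz[OF z] by simp
    have "norm (G z - poly q z) \<le> c * exp (\<rho> * Re z) + C * norm (z + 4) ^ d"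
      using bound[OF z] norm_poly_le_power[OF nz[OF z], of q']
      by (intro order_trans[OF norm_triangle_ineq4] add_mono) (auto simp: q' C_def d_def)
    also have "\<dots> \<le> c * exp (\<rho> * Re z) * norm (z + 4) ^ d + C * norm (z + 4) ^ d"
      using mult_left_mono[OF D, of "c * exp (\<rho> * Re z)"] c by simp
    finally have "norm (G z - poly q z) * exp (- \<rho> * Re z)
        \<le> (c * exp (\<rho> * Re z) + C) * norm (z + 4) ^ d * exp (- \<rho> * Re z)"
      by (intro mult_right_mono) (auto simp: algebra_simps)
    also have "\<dots> = (c + C * exp (- \<rho> * Re z)) * norm (z + 4) ^ d"
      by (simp add: algebra_simps flip: exp_add)
    also have "\<dots> \<le> (c + C * exp (3 * \<rho>)) * norm (z + 4) ^ d"
    proof (intro mult_right_mono add_left_mono mult_left_mono C)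
      have "\<rho> * (-3) \<le> \<rho> * Re z" using assms(3) z by (intro mult_left_mono) auto
      thus "exp (- \<rho> * Re z) \<le> exp (3 * \<rho>)" by simp
    qed auto
    finally show "norm (h z) \<le> c + C * exp (3 * \<rho>)"
      unfolding h_def norm_divide norm_mult norm_power
      using nz'[OF z] by (simp add: pos_divide_le_eq)
  qed (use w interp in \<open>auto simp: h_def\<close>)
  thus ?thesis using nz'[OF w] by (simp add: h_def)
qed

section \<open>Functions that interpolate primary pseudo-polynomials\<close>

lemma of_int_funpow_fwd_diff:
  "of_int ((fwd_diff ^^ k) a n) = (fwd_diff ^^ k) (\<lambda>j. of_int (a j)) n"
  by (simp add: funpow_fwd_diff_eq_sum)

theorem theorem4:
  fixes a :: "nat \<Rightarrow> int" and F :: "complex \<Rightarrow> complex" and u c \<rho> :: real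
  assumes "primary_pseudo_polynomial a"
    and "F analytic_on {x. Re x > u}"
    and "\<And>n :: nat. real n > u \<Longrightarrow> of_int (a n) = F (of_nat n)"
    and "c > 0"
    and "0 < \<rho>" and "\<rho> < ln (2 * sqrt (exp 1))"
    and "\<And>x. Re x > u \<Longrightarrow> norm (F x) \<le> c * exp (\<rho> * Re x)"
  shows "rational_polynomial_on {x. Re x > u} F \<and> is_polynomial a"
proof -
  \<comment> \<open>The shift makes room for the contours, whose left sides lie at \<open>-1\<close> and \<open>-2\<close>.\<close>
  define m where "m = nat \<lceil>\<bar>u\<bar>\<rceil> + 3"
  have m: "real m \<ge> u + 3" "real m \<ge> 3" unfolding m_def by linarith+
  have F: "F holomorphic_on {x. Re x > u}"
    using assms(2) by (rule analytic_imp_holomorphic)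
  define G where "G = (\<lambda>z. F (z + of_nat m))"
  have G: "G holomorphic_on {z. Re z > -3}"
    unfolding G_def
    by (rule holomorphic_on_compose_gen[OF _ F, unfolded o_def])
       (use m in \<open>auto intro!: holomorphic_intros\<close>)
  have Gn: "G (of_nat n) = of_int (a (n + m))" for n
    using assms(3)[of "n + m"] m by (simp add: G_def)
  have G_bound: "norm (G z) \<le> c * exp (\<rho> * m) * exp (\<rho> * Re z)" if "Re z > -3" for z
    using assms(7)[of "z + of_nat m"] that m by (simp add: G_def algebra_simps exp_add)
  have "exp \<rho> \<le> 33/10"
  proof -
    have "exp (1::real) < 2.7225" using e_less_272 by simp
    hence "sqrt (exp 1) \<le> 1.65" by (intro real_le_lsqrt) (auto simp: power2_eq_square)
    moreover have "exp \<rho> < exp (ln (2 * sqrt (exp 1)))" using assms(6) by (rule exp_less_mono)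
    ultimately show ?thesis by simp
  qed
  hence \<rho>: "\<rho> \<le> ln (33/10)" by (simp add: ln_ge_iff)
  \<comment> \<open>Raising the base is harmless on the left half-plane too, because \<open>Re z + m\<close> is nonnegative.\<close>
  have G_bound': "norm (G z) \<le> c * (33/10) ^ m * (33/10) powr Re z" if z: "Re z > -3" for z
  proof -
    have "norm (G z) \<le> c * exp (\<rho> * (Re z + m))"
      using G_bound[OF z] by (simp add: algebra_simps exp_add)
    also have "\<dots> \<le> c * exp (ln (33/10) * (Re z + m))"
      using \<rho> z m assms(4) by (intro mult_left_mono) (auto intro: mult_right_mono)
    also have "\<dots> = c * ((33/10) powr (Re z + m))" by (simp add: powr_def mult.commute)
    also have "\<dots> = c * (33/10) ^ m * (33/10) powr Re z"
      by (simp add: powr_add powr_realpow)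
    finally show ?thesis .
  qed
  have poly: "is_polynomial a"
  proof (rule is_polynomial_if_fwd_diff_small[OF assms(1)])
    fix k
    have "(fwd_diff ^^ k) (\<lambda>j. G (of_nat j)) 0 = of_int ((fwd_diff ^^ k) (\<lambda>n. a (n + m)) 0)"
      by (simp add: of_int_funpow_fwd_diff Gn)
    thus "\<bar>real_of_int ((fwd_diff ^^ k) (\<lambda>n. a (n + m)) 0)\<bar> \<le> 50 * (c * (33/10) ^ m) * (real k + 1) * (23/10) ^ k"
      using funpow_fwd_diff_growth_bound[OF G G_bound', of k] by simp
  qed
  then obtain P :: "rat poly" where P: "\<And>n. of_int (a n) = poly P (of_nat n)"
    unfolding is_polynomial_def by blast
  define Q :: "complex poly" where "Q = map_poly of_rat P"
  have Q: "poly Q (of_nat n) = of_int (a n)" for n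
    unfolding Q_def poly_map_of_rat_of_nat by (metis P of_rat_of_int_eq)
  have FQ: "F z = poly Q z" if "Re z > real m - 3" for z
  proof -
    have "G (z - of_nat m) = poly (pcompose Q [:of_nat m, 1:]) (z - of_nat m)"
    proof (rule exp_growth_interpolates_poly_imp_eq[OF G G_bound])
      show "G (of_nat n) = poly (pcompose Q [:of_nat m, 1:]) (of_nat n)" for n
        using Q[of "n + m"] by (simp add: Gn poly_pcompose add.commute)
    qed (use that assms(5) in auto)
    thus ?thesis by (simp add: G_def poly_pcompose)
  qed
  have "F z = poly Q z" if z: "Re z > u" for z
  proof (rule analytic_continuation_open[of "{z. Re z > real m - 3}" "{x. Re x > u}" F "poly Q"])
    have "of_nat m \<in> {z. Re z > real m - 3}" by simp
    thus "{z. Re z > real m - 3} \<noteq> {}" by blast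
  qed (use F FQ z m in \<open>auto intro!: holomorphic_intros open_halfspace_Re_gt convex_connected convex_halfspace_Re_gt\<close>)
  thus ?thesis
    using poly unfolding rational_polynomial_on_def Q_def by blast
qed

end
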